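(* Let $G$ be a (finite simple) chordal graph of minimum degree $k$ and let $p$ be a nonnegative integer with $p<k$. Then $G$ contains a chordal spanning subgraph of minimum degree $p$.
   Context: All graphs are finite and simple. A chord of a cycle $C$ in a graph is an edge of the graph not in $E(C)$ both of whose endpoints lie on $C$. A graph is chordal if every cycle of length greater than three has a chord (equivalently, it contains no induced cycle of length greater than three). Chordal graphs are not required to be connected. A spanning subgraph of $G$ is a subgraph with the same vertex set as $G$. "Minimum degree $p$" means that the minimum degree is exactly $p$. *)

theory Defs
  imports "Graph_Theory.Graph_Theory"
begin

text \<open>
  A finite simple graph is a \<^term>\<open>pair_graph\<close>: an undirected edge is a pair of antiparallel arcs.
  A library cycle is a closed arc list, and may be a single edge traversed forth and back; with more
  than two arcs its vertices are pairwise distinct, so it is an undirected cycle with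
  \<^term>\<open>length c\<close> edges. Since it is closed, its vertices are the tails of its arcs.
\<close>

definition chord :: "'a pair_pre_digraph \<Rightarrow> ('a \<times> 'a) list \<Rightarrow> 'a \<times> 'a \<Rightarrow> bool" where
  "chord G c e \<longleftrightarrow>
     e \<in> parcs G \<and> e \<notin> set c \<and> prod.swap e \<notin> set c \<and>
     fst e \<in> fst ` set c \<and> snd e \<in> fst ` set c"

definition chordal :: "'a pair_pre_digraph \<Rightarrow> bool" where
  "chordal G \<longleftrightarrow>
     (\<forall>c. pre_digraph.cycle (with_proj G) c \<and> length c > 3 \<longrightarrow> (\<exists>e. chord G c e))"

text \<open>
  In a symmetric digraph the out-degree of a vertex is its number of neighbours.
  The minimum is meaningful only for nonempty vertex sets.
\<close>

definition min_degree :: "'a pair_pre_digraph \<Rightarrow> nat" where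
  "min_degree G = Min (out_degree (with_proj G) ` pverts G)"

end

theory Submission
  imports Defs
begin

text \<open>
  Deleting one edge lowers the minimum degree by at most one, so it suffices to delete edges one at a
  time, keeping the graph chordal, until the minimum degree is \<open>p\<close>. By Dirac's theorem there is
  a vertex \<open>u\<close> whose neighbours form a clique, and any edge at \<open>u\<close> may go: a cycle of
  length greater than three through \<open>u\<close> has the two neighbours of \<open>u\<close> on it joined by a chord,
  and a chord of a cycle avoiding \<open>u\<close> survives.
\<close>

section \<open>Chordality of the adjacency relation\<close>

definition cycle_arcs :: "'a list \<Rightarrow> 'a rel" where
  "cycle_arcs vs = set (zip vs (rotate1 vs))"

text \<open>Cycles appear here as cyclic vertex lists, so that rotating a cycle or splitting it at a
  vertex is ordinary list manipulation. \<open>cycle_arcs\<close> carries each edge in one direction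
  only, hence both orientations are excluded.\<close>

definition chordal_rel :: "'a rel \<Rightarrow> bool" where
  "chordal_rel E \<longleftrightarrow>
     (\<forall>vs. distinct vs \<and> 3 < length vs \<and> cycle_arcs vs \<subseteq> E \<longrightarrow>
        (\<exists>a\<in>set vs. \<exists>b\<in>set vs. (a, b) \<in> E \<and> (a, b) \<notin> cycle_arcs vs \<and> (b, a) \<notin> cycle_arcs vs))"

lemma pcas_iff: "pcas u c v \<longleftrightarrow> u # map snd c = map fst c @ [v]"
  by (induction c arbitrary: u) auto

lemma tl_pawalk_verts: "pcas u c v \<Longrightarrow> tl (pawalk_verts u c) = map snd c"
proof (induction c arbitrary: u)
  case (Cons e es)
  then show ?case by (cases es) auto
qed simp

text \<open>The library asks for distinctness of \<open>tl (pawalk_verts u c)\<close>, which is the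
  list of heads. On a closed walk the heads are the tails shifted by one, and the base point
  \<open>u\<close> is forced to be the first tail, so it can be eliminated.\<close>

lemma cycle_with_proj_iff:
  assumes "pair_wf_digraph G"
  shows "pre_digraph.cycle (with_proj G) c \<longleftrightarrow>
    c \<noteq> [] \<and> set c \<subseteq> parcs G \<and> distinct (map fst c) \<and> map snd c = rotate1 (map fst c)"
proof -
  interpret pair_wf_digraph G by fact
  have "pcas u c u \<and> distinct (tl (pawalk_verts u c)) \<longleftrightarrow> pcas u c u \<and> distinct (map snd c)" for u
    by (auto simp: tl_pawalk_verts)
  then have "cycle c \<longleftrightarrow>
    (\<exists>u. u \<in> pverts G \<and> set c \<subseteq> parcs G \<and> pcas u c u \<and> distinct (map snd c) \<and> c \<noteq> [])"
    unfolding cycle_def awalk_def by blast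
  also have "\<dots> \<longleftrightarrow> c \<noteq> [] \<and> set c \<subseteq> parcs G \<and> distinct (map fst c) \<and> map snd c = rotate1 (map fst c)"
  proof (cases c)
    case (Cons e es)
    have closed: "pcas u c u \<longleftrightarrow> u = fst e \<and> map snd c = rotate1 (map fst c)" for u
      unfolding pcas_iff Cons by auto
    have "distinct (map snd c) \<longleftrightarrow> distinct (map fst c)" if "map snd c = rotate1 (map fst c)"
      unfolding that by simp
    moreover have "fst e \<in> pverts G" if "set c \<subseteq> parcs G"
      using that Cons arc_fst_in_verts by auto
    ultimately show ?thesis
      unfolding closed by blast
  qed simp
  finally show ?thesis .
qed

text \<open>Taking tails and forming \<open>zip vs (rotate1 vs)\<close> are mutually inverse
  passages between library cycles and cyclic vertex lists, and both preserve the set of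
  arcs.\<close>

lemma chordal_iff_chordal_rel:
  assumes "pair_wf_digraph G"
  shows "chordal G \<longleftrightarrow> chordal_rel (parcs G)"
proof
  assume G: "chordal G"
  show "chordal_rel (parcs G)"
    unfolding chordal_rel_def
  proof (intro allI impI)
    fix vs :: "'a list"
    assume vs: "distinct vs \<and> 3 < length vs \<and> cycle_arcs vs \<subseteq> parcs G"
    let ?c = "zip vs (rotate1 vs)"
    have c: "map fst ?c = vs" "map snd ?c = rotate1 vs" by auto
    have "pre_digraph.cycle (with_proj G) ?c" "3 < length ?c"
      using vs c by (auto simp: cycle_with_proj_iff[OF assms] cycle_arcs_def)
    then obtain e where "chord G ?c e" using G unfolding chordal_def by blast
    moreover have "fst ` set ?c = set vs" using c(1) by (metis set_map)
    ultimately show "\<exists>a\<in>set vs. \<exists>b\<in>set vs. (a, b) \<in> parcs G \<and> (a, b) \<notin> cycle_arcs vs \<and> (b, a) \<notin> cycle_arcs vs"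
      unfolding chord_def cycle_arcs_def by (cases e) auto
  qed
next
  assume G: "chordal_rel (parcs G)"
  show "chordal G"
    unfolding chordal_def
  proof (intro allI impI)
    fix c
    assume c: "pre_digraph.cycle (with_proj G) c \<and> 3 < length c"
    have "c = zip (map fst c) (map snd c)" by (simp add: zip_map_fst_snd)
    then have arcs: "cycle_arcs (map fst c) = set c"
      using c by (simp add: cycle_with_proj_iff[OF assms] cycle_arcs_def)
    have "distinct (map fst c) \<and> 3 < length (map fst c) \<and> cycle_arcs (map fst c) \<subseteq> parcs G"
      using c arcs by (auto simp: cycle_with_proj_iff[OF assms])
    then obtain a b where "a \<in> set (map fst c)" "b \<in> set (map fst c)" "(a, b) \<in> parcs G"
      "(a, b) \<notin> set c" "(b, a) \<notin> set c"
      using G arcs unfolding chordal_rel_def by metis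
    then have "chord G c (a, b)" by (simp add: chord_def)
    then show "\<exists>e. chord G c e" by blast
  qed
qed

section \<open>Induced paths\<close>

text \<open>Nonadjacency is tested only from a vertex to later ones; symmetry of \<open>E\<close>
  supplies the other direction in \<open>induced_path_no_chord\<close>. The second clause covers
  lists of length at most one.\<close>

fun induced_path :: "'a rel \<Rightarrow> 'a list \<Rightarrow> bool" where
  "induced_path E (x # y # xs) \<longleftrightarrow>
     (x, y) \<in> E \<and> x \<notin> set (y # xs) \<and> (\<forall>z\<in>set xs. (x, z) \<notin> E) \<and> induced_path E (y # xs)"
| "induced_path E xs \<longleftrightarrow> True"

lemma induced_path_suffix: "induced_path E (xs @ ys) \<Longrightarrow> induced_path E ys"
proof (induction xs)
  case (Cons x xs)
  then show ?case by (cases "xs @ ys") auto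
qed simp

lemma induced_path_distinct: "induced_path E xs \<Longrightarrow> distinct xs"
  by (induction E xs rule: induced_path.induct) auto

lemma induced_path_steps: "induced_path E xs \<Longrightarrow> set (zip xs (tl xs)) \<subseteq> E"
  by (induction E xs rule: induced_path.induct) auto

lemma induced_path_no_chord:
  assumes "induced_path E xs" "sym E" "irrefl E" "a \<in> set xs" "b \<in> set xs" "(a, b) \<in> E"
  shows "(a, b) \<in> set (zip xs (tl xs)) \<or> (b, a) \<in> set (zip xs (tl xs))"
  using assms
proof (induction E xs rule: induced_path.induct)
  case (1 E x y xs)
  then show ?case by (auto simp: irrefl_def dest: symD)
qed (auto simp: irrefl_def)

text \<open>The path is built backwards from \<open>b\<close>. A new vertex is attached to its last
  neighbour on the path so far and everything before that neighbour is dropped, so no later vertex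
  is adjacent to the new one.\<close>

lemma induced_path_exists:
  assumes "(a, b) \<in> (E \<inter> T \<times> T)\<^sup>*" "a \<in> T"
  shows "\<exists>xs. xs \<noteq> [] \<and> hd xs = a \<and> last xs = b \<and> set xs \<subseteq> T \<and> induced_path E xs"
  using assms
proof (induction rule: converse_rtrancl_induct)
  case base
  then show ?case by (intro exI[of _ "[b]"]) auto
next
  case (step a c)
  then obtain xs where xs: "xs \<noteq> []" "hd xs = c" "last xs = b" "set xs \<subseteq> T" "induced_path E xs"
    by auto
  show ?case
  proof (cases "a \<in> set xs")
    case True
    \<comment> \<open>The path already passes through \<open>a\<close>, so its suffix from
      \<open>a\<close> serves.\<close>
    then obtain us ws where "xs = us @ a # ws" by (meson split_list)
    then show ?thesis
      using xs induced_path_suffix[of E us "a # ws"] by (intro exI[of _ "a # ws"]) auto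
  next
    case False
    have "\<exists>z\<in>set xs. (a, z) \<in> E" using step.hyps(1) xs(1,2) by (metis IntD1 hd_in_set)
    from split_list_last_prop[OF this] obtain us z ws
      where split: "xs = us @ z # ws" "(a, z) \<in> E" "\<forall>y\<in>set ws. (a, y) \<notin> E" by auto
    then have "induced_path E (z # ws)" using xs(5) induced_path_suffix by metis
    then show ?thesis
      using xs split False step.prems by (intro exI[of _ "a # z # ws"]) auto
  qed
qed

section \<open>Simplicial vertices\<close>

text \<open>Taken relative to \<open>W\<close> so that an induction can shrink the vertex set while
  \<open>E\<close> stays fixed.\<close>

definition simplicial :: "'a rel \<Rightarrow> 'a set \<Rightarrow> 'a \<Rightarrow> bool" where
  "simplicial E W u \<longleftrightarrow>
     u \<in> W \<and> (\<forall>a\<in>W. \<forall>b\<in>W. (u, a) \<in> E \<longrightarrow> (u, b) \<in> E \<longrightarrow> a \<noteq> b \<longrightarrow> (a, b) \<in> E)"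

text \<open>Otherwise an induced path from \<open>x\<close> to \<open>y\<close> with interior in
  \<open>D\<close>, closed up through \<open>v\<close>, is a cycle of length at least four. A chord
  of it cannot join two path vertices, as the path is induced, nor end at \<open>v\<close>, whose
  only neighbours on it are \<open>x\<close> and \<open>y\<close>. This is why minimal separators of
  chordal graphs are cliques.\<close>

lemma common_neighbours_adjacent:
  assumes E: "sym E" "irrefl E" "chordal_rel E"
    and v: "(v, x) \<in> E" "(v, y) \<in> E" "x \<noteq> y"
    and D: "v \<notin> D" "\<And>d. d \<in> D \<Longrightarrow> (v, d) \<notin> E"
    and path: "(x, c) \<in> E" "(c, d) \<in> (E \<inter> D \<times> D)\<^sup>*" "(d, y) \<in> E" "c \<in> D"
  shows "(x, y) \<in> E"
proof (rule ccontr)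
  assume nadj: "(x, y) \<notin> E"
  let ?T = "insert x (insert y D)"
  have "(c, d) \<in> (E \<inter> ?T \<times> ?T)\<^sup>*"
    using path(2) by (rule rtrancl_mono[THEN subsetD, rotated]) auto
  moreover have "d \<in> D" using path(2,4) by (induction rule: rtrancl_induct) auto
  ultimately have "(x, y) \<in> (E \<inter> ?T \<times> ?T)\<^sup>*"
    using path(1,3,4)
    by (metis (no_types, lifting) IntI SigmaI converse_rtrancl_into_rtrancl insertCI rtrancl.rtrancl_into_rtrancl)
  from induced_path_exists[OF this] obtain qs
    where qs: "qs \<noteq> []" "hd qs = x" "last qs = y" "set qs \<subseteq> ?T" "induced_path E qs" by auto
  obtain q where q: "qs = x # q" using qs(1,2) by (cases qs) auto
  have "q \<noteq> []" using q qs(3) v(3) by auto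
  then obtain r where r: "qs = x # r @ [y]" using q qs(3) by (metis append_butlast_last_id last_ConsR)
  \<comment> \<open>An empty interior would make \<open>x\<close> and \<open>y\<close>
    adjacent.\<close>
  have "r \<noteq> []" using r qs(5) nadj by auto
  then have len: "3 < length (v # qs)" using r by (cases r) auto
  have "v \<noteq> x" "v \<noteq> y" using v E(2) by (auto simp: irrefl_def)
  then have vqs: "v \<notin> set qs" using qs(4) D(1) by auto
  have "zip (v # qs) (rotate1 (v # qs)) = (v, x) # zip qs (tl qs @ [v])"
    using r by simp
  also have "zip qs (tl qs @ [v]) = zip qs (tl qs) @ [(y, v)]"
  proof -
    have "zip ((x # r) @ [y]) ((r @ [y]) @ [v]) = zip (x # r) (r @ [y]) @ [(y, v)]"
      by (subst zip_append) auto
    moreover have "zip ((x # r) @ [y]) ((r @ [y]) @ []) = zip (x # r) (r @ [y])"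
      by (subst zip_append) auto
    ultimately show ?thesis using r by simp
  qed
  finally have arcs: "cycle_arcs (v # qs) = insert (v, x) (insert (y, v) (set (zip qs (tl qs))))"
    by (auto simp: cycle_arcs_def)
  have "cycle_arcs (v # qs) \<subseteq> E"
    using arcs induced_path_steps[OF qs(5)] v E(1) by (auto dest: symD)
  moreover have "distinct (v # qs)" using vqs induced_path_distinct[OF qs(5)] by simp
  ultimately obtain a b where ab: "a \<in> set (v # qs)" "b \<in> set (v # qs)" "(a, b) \<in> E"
      "(a, b) \<notin> cycle_arcs (v # qs)" "(b, a) \<notin> cycle_arcs (v # qs)"
    using E(3) len unfolding chordal_rel_def by blast
  have spoke: "z = x \<or> z = y" if "z \<in> set qs" "(v, z) \<in> E" for z
    using that qs(4) D(2) by auto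
  have "a \<noteq> b" using ab(3) E(2) by (auto simp: irrefl_def)
  then consider "a = v" "b \<in> set qs" | "b = v" "a \<in> set qs" | "a \<in> set qs" "b \<in> set qs"
    using ab(1,2) by auto
  then show False
  proof cases
    case 1
    then show False using spoke[of b] ab(3-5) arcs by auto
  next
    case 2
    then show False using spoke[of a] symD[OF E(1) ab(3)] ab(4,5) arcs by auto
  next
    case 3
    then show False using induced_path_no_chord[OF qs(5) E(1,2) 3 ab(3)] ab(4,5) arcs by simp
  qed
qed

text \<open>Dirac's theorem in a form strong enough for induction on the size of \<open>W\<close>:
  the simplicial vertex can be sought away from any prescribed \<open>v\<close> that has a
  nonneighbour.\<close>

lemma simplicial_nonneighbour_exists:
  assumes E: "sym E" "irrefl E" "chordal_rel E"
    and "finite W" "v \<in> W" "c \<in> W" "c \<noteq> v" "(v, c) \<notin> E"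
  shows "\<exists>u. simplicial E W u \<and> u \<noteq> v \<and> (v, u) \<notin> E"
  using assms(4-)
proof (induction "card W" arbitrary: W v c rule: less_induct)
  case less
  \<comment> \<open>\<open>D\<close> holds the nonneighbours of \<open>v\<close>, \<open>C\<close>
    is the component of \<open>c\<close> in \<open>D\<close>, and \<open>S\<close> consists of the
    neighbours of \<open>v\<close> attached to \<open>C\<close>; it separates \<open>C\<close> from
    \<open>v\<close>.\<close>
  define D where "D = {w \<in> W. w \<noteq> v \<and> (v, w) \<notin> E}"
  define C where "C = (E \<inter> D \<times> D)\<^sup>* `` {c}"
  define S where "S = {s \<in> W. (v, s) \<in> E \<and> (\<exists>d\<in>C. (d, s) \<in> E)}"
  have cC: "c \<in> C" by (simp add: C_def)
  have cD: "c \<in> D" using less.prems by (simp add: D_def)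
  have CD: "C \<subseteq> D"
  proof
    fix d assume "d \<in> C"
    then have "(c, d) \<in> (E \<inter> D \<times> D)\<^sup>*" by (simp add: C_def)
    then show "d \<in> D" using cD by (induction rule: rtrancl_induct) auto
  qed
  \<comment> \<open>All neighbours in \<open>W\<close> of a vertex of \<open>C\<close> lie in
    \<open>C\<close> or \<open>S\<close>. Hence a vertex of \<open>C\<close> that is simplicial in
    the union of \<open>C\<close> and \<open>S\<close> is simplicial in \<open>W\<close>.\<close>
  have nbr: "w \<in> C \<union> S" if d: "d \<in> C" and w: "w \<in> W" "(d, w) \<in> E" for d w
  proof (cases "w \<in> D")
    case True
    then have "(d, w) \<in> E \<inter> D \<times> D" using w d CD by auto
    then show ?thesis using d by (auto simp: C_def intro: rtrancl_into_rtrancl)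
  next
    case False
    then have "(v, w) \<in> E" using w d CD E(1) by (auto simp: D_def dest: symD)
    then show ?thesis using w d by (auto simp: S_def)
  qed
  have clique: "(x, y) \<in> E" if xy: "x \<in> S" "y \<in> S" "x \<noteq> y" for x y
  proof -
    obtain a b where ab: "a \<in> C" "(a, x) \<in> E" "b \<in> C" "(b, y) \<in> E"
      using xy unfolding S_def by blast
    have "sym (E \<inter> D \<times> D)" using E(1) by (auto simp: sym_def)
    then have "(a, c) \<in> (E \<inter> D \<times> D)\<^sup>*"
      using ab(1) by (auto simp: C_def dest: sym_rtrancl symD)
    then have path: "(a, b) \<in> (E \<inter> D \<times> D)\<^sup>*" using ab(3) by (auto simp: C_def)
    show ?thesis
      by (rule common_neighbours_adjacent[OF E, of v x y D a b])
        (use xy ab path CD E(1) in \<open>auto simp: S_def D_def dest: symD\<close>)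
  qed
  let ?W = "C \<union> S"
  have sub: "?W \<subseteq> W - {v}" using CD E(2) by (auto simp: D_def S_def irrefl_def)
  then have small: "card ?W < card W" "finite ?W"
    using less.prems(1,2) by (auto intro!: psubset_card_mono intro: finite_subset)
  have lift: "\<exists>u. simplicial E W u \<and> u \<noteq> v \<and> (v, u) \<notin> E" if "u \<in> C" "simplicial E ?W u" for u
  proof (intro exI[of _ u] conjI)
    show "simplicial E W u" using that nbr[OF that(1)] CD unfolding simplicial_def D_def by blast
  qed (use that CD in \<open>auto simp: D_def\<close>)
  \<comment> \<open>The simplicial vertex of \<open>?W\<close> must land in \<open>C\<close>. If
    some \<open>s\<close> in \<open>S\<close> has a nonneighbour in \<open>?W\<close>, a simplicial
    nonneighbour of \<open>s\<close> avoids the clique \<open>S\<close>. Otherwise all of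
    \<open>S\<close> is adjacent to everything in \<open>?W\<close>, so a simplicial nonneighbour of
    some \<open>d\<close> in \<open>C\<close> avoids \<open>S\<close>. If there is no such
    \<open>d\<close> either, \<open>?W\<close> is a clique and \<open>c\<close> itself
    serves.\<close>
  show ?case
  proof (cases "\<exists>s\<in>S. \<exists>z\<in>?W. z \<noteq> s \<and> (s, z) \<notin> E")
    case True
    then obtain s z where "s \<in> S" "z \<in> ?W" "z \<noteq> s" "(s, z) \<notin> E" by blast
    with less.hyps[OF small, of s z] obtain u
      where u: "simplicial E ?W u" "u \<noteq> s" "(s, u) \<notin> E" by auto
    then have "u \<in> C" using clique[OF \<open>s \<in> S\<close>, of u] by (auto simp: simplicial_def)
    then show ?thesis using lift u by blast
  next
    case univ: False
    show ?thesis
    proof (cases "\<exists>d\<in>C. \<exists>z\<in>?W. z \<noteq> d \<and> (d, z) \<notin> E")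
      case True
      then obtain d z where "d \<in> C" "z \<in> ?W" "z \<noteq> d" "(d, z) \<notin> E" by blast
      with less.hyps[OF small, of d z] obtain u
        where u: "simplicial E ?W u" "u \<noteq> d" "(d, u) \<notin> E" by auto
      then have "(u, d) \<notin> E" using E(1) by (blast dest: symD)
      then have "u \<notin> S" using univ u(2) \<open>d \<in> C\<close> by auto
      then have "u \<in> C" using u(1) by (simp add: simplicial_def)
      then show ?thesis using lift u by blast
    next
      case False
      then have "(a, b) \<in> E" if "a \<in> ?W" "b \<in> ?W" "a \<noteq> b" for a b
        using univ that by (metis UnE)
      then have "simplicial E ?W c" using cC unfolding simplicial_def by blast
      then show ?thesis using lift cC by blast
    qed
  qed
qed

lemma simplicial_exists:
  assumes "sym E" "irrefl E" "chordal_rel E" "finite W" "W \<noteq> {}"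
  shows "\<exists>u. simplicial E W u"
proof (cases "\<exists>v\<in>W. \<exists>c\<in>W. c \<noteq> v \<and> (v, c) \<notin> E")
  case True
  then show ?thesis using simplicial_nonneighbour_exists[OF assms(1-4)] by blast
next
  case False
  then have "(a, b) \<in> E" if "a \<in> W" "b \<in> W" "a \<noteq> b" for a b
    using that by metis
  then show ?thesis using assms(5) unfolding simplicial_def by auto
qed

section \<open>Deleting an edge at a simplicial vertex\<close>

text \<open>Allows a cycle to be read from any of its vertices.\<close>

lemma cycle_arcs_rotate1: "cycle_arcs (rotate1 vs) = cycle_arcs vs"
proof -
  have "zip (rotate1 vs) (rotate1 (rotate1 vs)) = rotate1 (zip vs (rotate1 vs))"
  proof (cases vs)
    case (Cons x xs)
    have "zip (y # ys @ [x]) ((ys @ [x]) @ [y]) = zip (y # ys) (ys @ [x]) @ [(x, y)]" for y and ys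
      using zip_append[of "y # ys" "ys @ [x]" "[x]" "[y]"] by simp
    then show ?thesis using Cons by (cases xs) auto
  qed simp
  then show ?thesis by (simp add: cycle_arcs_def)
qed

lemma cycle_arcs_rotate: "cycle_arcs (rotate n vs) = cycle_arcs vs"
  by (induction n) (auto simp: cycle_arcs_rotate1)

text \<open>As \<open>W\<close> contains all endpoints of \<open>E\<close>, simpliciality covers
  every neighbour of \<open>u\<close>. Whether or not the cycle meets \<open>u\<close>, the chord
  produced avoids \<open>u\<close>, so it is not the deleted edge.\<close>

lemma chordal_rel_delete_edge:
  assumes chordal: "chordal_rel E" and "sym E"
    and simp: "simplicial E W u" and W: "E \<subseteq> W \<times> W"
  shows "chordal_rel (E - {(u, w), (w, u)})"
  unfolding chordal_rel_def
proof (intro allI impI)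
  fix vs :: "'a list"
  let ?E = "E - {(u, w), (w, u)}"
  assume vs: "distinct vs \<and> 3 < length vs \<and> cycle_arcs vs \<subseteq> ?E"
  show "\<exists>a\<in>set vs. \<exists>b\<in>set vs. (a, b) \<in> ?E \<and> (a, b) \<notin> cycle_arcs vs \<and> (b, a) \<notin> cycle_arcs vs"
  proof (cases "u \<in> set vs")
    case False
    from vs have "cycle_arcs vs \<subseteq> E" by blast
    with vs chordal[unfolded chordal_rel_def, rule_format, of vs] obtain a b where "a \<in> set vs" "b \<in> set vs" "(a, b) \<in> E"
      "(a, b) \<notin> cycle_arcs vs" "(b, a) \<notin> cycle_arcs vs" by auto
    with False show ?thesis by blast
  next
    case True
    then obtain xs ys where "vs = xs @ u # ys" by (meson split_list)
    then have rot: "rotate (length xs) vs = u # ys @ xs" by (simp add: rotate_append)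
    define zs where "zs = ys @ xs"
    have "cycle_arcs (u # zs) = cycle_arcs vs" "set (u # zs) = set vs" "distinct (u # zs)"
      "length (u # zs) = length vs"
      unfolding zs_def rot[symmetric] using vs by (simp_all add: cycle_arcs_rotate)
    note zs = this
    \<comment> \<open>The rotated cycle reads \<open>u\<close>, \<open>b\<close>, \<open>d\<close>,
      ..., \<open>a\<close>. Length above three puts \<open>d\<close> strictly between
      \<open>b\<close> and \<open>a\<close>, so these two neighbours of \<open>u\<close> are not
      consecutive on the cycle.\<close>
    obtain b bs where b: "zs = b # bs" using zs(4) vs by (cases zs) auto
    obtain cs a where a: "bs = cs @ [a]" using zs(4) vs b by (cases bs rule: rev_cases) auto
    obtain d ds where d: "cs = d # ds" using zs(4) vs a b by (cases cs) auto
    have arcs: "cycle_arcs (u # zs) = {(u, b), (b, d), (a, u)} \<union> set (zip (d # ds) (ds @ [a]))"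
    proof -
      have "zip ((d # ds) @ [a]) ((ds @ [a]) @ [u]) = zip (d # ds) (ds @ [a]) @ [(a, u)]"
        by (subst zip_append) auto
      then show ?thesis unfolding cycle_arcs_def b a d by auto
    qed
    have "(u, a) \<in> E" "(u, b) \<in> E" using vs arcs zs(1) \<open>sym E\<close> by (auto dest: symD)
    moreover have ne: "a \<noteq> b" "a \<noteq> u" "b \<noteq> u" "a \<noteq> d" "d \<noteq> u" "b \<noteq> d" "a \<notin> set (d # ds)" "b \<notin> set (d # ds)"
      using zs(3) a b d by auto
    ultimately have "(a, b) \<in> ?E" using simp W unfolding simplicial_def by blast
    moreover have "(a, b) \<notin> cycle_arcs vs" "(b, a) \<notin> cycle_arcs vs"
      unfolding zs(1)[symmetric] arcs using ne by (auto dest: set_zip_leftD)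
    moreover have "a \<in> set vs" "b \<in> set vs" unfolding zs(2)[symmetric] by (auto simp: a b)
    ultimately show ?thesis by blast
  qed
qed

section \<open>Minimum degree under edge deletion\<close>

lemma out_degree_with_proj: "out_degree (with_proj G) v = card (parcs G `` {v})"
proof -
  have "out_arcs (with_proj G) v = Pair v ` (parcs G `` {v})" by (auto simp: out_arcs_def)
  then show ?thesis by (simp add: out_degree_def card_image inj_on_def)
qed

lemma min_degree_ge_iff:
  assumes "finite (pverts G)" "pverts G \<noteq> {}"
  shows "n \<le> min_degree G \<longleftrightarrow> (\<forall>v\<in>pverts G. n \<le> card (parcs G `` {v}))"
  using assms by (simp add: min_degree_def out_degree_with_proj)

lemma chordal_delete_edge_exists:
  fixes G :: "'a pair_pre_digraph"
  assumes "pair_graph G" "pverts G \<noteq> {}" "chordal G" "0 < min_degree G"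
  shows "\<exists>H :: 'a pair_pre_digraph. pair_graph H \<and> pverts H = pverts G \<and> parcs H \<subset> parcs G \<and> chordal H \<and>
    min_degree G \<le> Suc (min_degree H)"
proof -
  interpret pair_graph G by fact
  have E: "sym (parcs G)" "irrefl (parcs G)" "parcs G \<subseteq> pverts G \<times> pverts G"
    using pair_sym_arcs
    by (auto simp: symmetric_def irrefl_def dest: pair_no_loops in_arcsD1 in_arcsD2)
  have chord: "chordal_rel (parcs G)"
    using assms(3) chordal_iff_chordal_rel[OF pair_wf_digraph_axioms] by simp
  obtain u where u: "simplicial (parcs G) (pverts G) u"
    using simplicial_exists[OF E(1,2) chord pair_finite_verts assms(2)] by blast
  have deg: "min_degree G \<le> card (parcs G `` {v})" if "v \<in> pverts G" for v
    using min_degree_ge_iff[OF pair_finite_verts assms(2)] that by blast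
  \<comment> \<open>Positive minimum degree guarantees that the simplicial vertex has an edge to
    delete.\<close>
  have "0 < card (parcs G `` {u})" using deg[of u] u assms(4) by (simp add: simplicial_def)
  then obtain w where w: "(u, w) \<in> parcs G" by (auto simp: card_gt_0_iff)
  define H where "H = \<lparr>pverts = pverts G, parcs = parcs G - {(u, w), (w, u)}\<rparr>"
  have "u \<noteq> w" using pair_no_loops[OF w] by simp
  have H: "pair_graph H"
  proof unfold_locales
    show "symmetric (with_proj H)"
      using E(1) by (auto simp: H_def symmetric_def sym_def)
  qed (use pair_no_loops pair_finite_verts pair_finite_arcs in \<open>auto simp: H_def dest: in_arcsD1 in_arcsD2\<close>)
  then interpret H: pair_graph H .
  have "chordal H"
    using chordal_rel_delete_edge[OF chord E(1) u E(3), of w]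
    by (simp add: chordal_iff_chordal_rel[OF H.pair_wf_digraph_axioms]) (simp add: H_def)
  moreover have "min_degree G \<le> Suc (min_degree H)"
  proof -
    have "min_degree G - 1 \<le> card (parcs H `` {v})" if v: "v \<in> pverts G" for v
    proof -
      \<comment> \<open>The lost neighbour is \<open>w\<close> at \<open>u\<close>, and
        \<open>u\<close> at \<open>w\<close>; other vertices lose none, and any \<open>z\<close>
        does.\<close>
      obtain z where "parcs G `` {v} - {z} \<subseteq> parcs H `` {v}"
        by (cases "v = u") (use \<open>u \<noteq> w\<close> in \<open>auto simp: H_def\<close>)
      moreover have "finite (parcs G `` {v})" "finite (parcs H `` {v})"
        using pair_finite_arcs H.pair_finite_arcs by (auto intro: finite_Image)
      ultimately have "card (parcs G `` {v}) - 1 \<le> card (parcs H `` {v})"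
        by (metis card_Diff_singleton_if card_mono diff_le_self order_trans)
      then show ?thesis using deg[OF v] by linarith
    qed
    then have "min_degree G - 1 \<le> min_degree H"
      using min_degree_ge_iff[OF H.pair_finite_verts] assms(2) by (simp add: H_def)
    then show ?thesis by linarith
  qed
  moreover have "pverts H = pverts G" "parcs H \<subset> parcs G" using w by (auto simp: H_def)
  ultimately show ?thesis using H by blast
qed

text \<open>A discrete intermediate value argument, with the number of arcs as induction measure.
  The bound on \<open>p\<close> is weak so that it survives every deletion down to the moment when
  \<open>p\<close> is reached.\<close>

lemma chordal_spanning_min_degree:
  fixes G :: "'a pair_pre_digraph"
  assumes "pair_graph G" "pverts G \<noteq> {}" "chordal G" "p \<le> min_degree G"
  shows "\<exists>H :: 'a pair_pre_digraph. pair_graph H \<and> pverts H = pverts G \<and> parcs H \<subseteq> parcs G \<and> chordal H \<and>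
    min_degree H = p"
  using assms
proof (induction "card (parcs G)" arbitrary: G rule: less_induct)
  case less
  show ?case
  proof (cases "min_degree G = p")
    case True
    then show ?thesis using less.prems by blast
  next
    case False
    \<comment> \<open>Here \<open>p < min_degree G\<close>, so the minimum degree is positive and is
      still at least \<open>p\<close> after the deletion.\<close>
    then obtain H :: "'a pair_pre_digraph" where H: "pair_graph H" "pverts H = pverts G"
      "parcs H \<subset> parcs G" "chordal H" "min_degree G \<le> Suc (min_degree H)"
      using chordal_delete_edge_exists[OF less.prems(1-3)] less.prems(4) by auto
    interpret pair_graph G by fact
    have "card (parcs H) < card (parcs G)"
      using H(3) pair_finite_arcs by (rule psubset_card_mono[rotated])
    from less.hyps[OF this H(1)] show ?thesis
      using H False less.prems by (auto 0 4)
  qed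
qed

theorem lemma3:
  fixes G :: "'a pair_pre_digraph" and k p :: nat
  assumes "pair_graph G"
    and "pverts G \<noteq> {}"
    and "chordal G"
    and "min_degree G = k"
    and "p < k"
  shows "\<exists>H :: 'a pair_pre_digraph.
           pair_graph H \<and> spanning (with_proj H) (with_proj G) \<and> chordal H \<and> min_degree H = p"
proof -
  obtain H :: "'a pair_pre_digraph" where H: "pair_graph H" "pverts H = pverts G"
    "parcs H \<subseteq> parcs G" "chordal H" "min_degree H = p"
    using chordal_spanning_min_degree[OF assms(1-3), of p] assms(4,5) by auto
  interpret G: pair_graph G by fact
  interpret H: pair_graph H by fact
  have "spanning (with_proj H) (with_proj G)"
    using H(2,3) G.wf_digraph_axioms H.wf_digraph_axioms
    by (simp add: spanning_def subgraph_def compatible_def)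
  then show ?thesis using H by blast
qed

end
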